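(* Let $\mathcal{A},\mathcal{B}\in\mathbb{C}^{\mathbf{N}(n)\times\mathbf{N}(n)}$ with $\mathrm{ind}(\mathcal{B})=\mathrm{ind}(\mathcal{A}*_n\mathcal{B})=\mathrm{ind}(\mathcal{A}*_n\mathcal{B}*_n\mathcal{B}^{\mathrm{core}})=1$. Then the following statements are equivalent: (a) $(\mathcal{A}*_n\mathcal{B})^{\mathrm{core}}=(\mathcal{A}*_n\mathcal{B})^{\#}=\mathcal{B}^{\mathrm{core}}*_n(\mathcal{A}*_n\mathcal{B}*_n\mathcal{B}^{\mathrm{core}})^{\mathrm{core}}$; (b) $\mathcal{B}^{\mathrm{core}}*_n(\mathcal{A}*_n\mathcal{B}*_n\mathcal{B}^{\mathrm{core}})^{\mathrm{core}}\in(\mathcal{A}*_n\mathcal{B})\{5\}$; (c) $\mathcal{B}*_n\mathcal{B}^{\mathrm{core}}*_n\mathcal{A}*_n\mathcal{B}=\mathcal{A}*_n\mathcal{B}=\mathcal{B}^{\mathrm{core}}*_n\mathcal{B}*_n\mathcal{A}*_n\mathcal{B}$ and $\mathcal{B}*_n\mathcal{A}*_n(\mathcal{A}*_n\mathcal{B}*_n\mathcal{B}^{\mathrm{core}})^{\mathrm{core}}=(\mathcal{A}*_n\mathcal{B}*_n\mathcal{B}^{\mathrm{core}})^{\mathrm{core}}*_n\mathcal{A}*_n\mathcal{B}$; (d) $(\mathcal{A}*_n\mathcal{B}*_n\mathcal{B}^{\mathrm{core}})^{\mathrm{core}}=\mathcal{B}*_n(\mathcal{A}*_n\mathcal{B}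)^{\#}$.
   Context: Here $\mathbf{N}(n)=N_1\times\cdots\times N_n$ and $\mathbb{C}^{\mathbf{N}(n)\times\mathbf{N}(n)}$ is the set of complex tensors $\mathcal{A}=(a_{i_1\ldots i_n j_1\ldots j_n})$ with $1\le i_k,j_k\le N_k$. The Einstein product is $(\mathcal{A}*_n\mathcal{B})_{i_1\ldots i_n j_1\ldots j_n}=\sum_{k_1,\ldots,k_n}a_{i_1\ldots i_n k_1\ldots k_n}b_{k_1\ldots k_n j_1\ldots j_n}$ (and similarly $\mathcal{A}*_n\mathcal{X}\in\mathbb{C}^{\mathbf{N}(n)}$ for $\mathcal{X}\in\mathbb{C}^{\mathbf{N}(n)}$), powers are taken with respect to $*_n$, and $\mathcal{A}^*$ is the conjugate transpose (swap the first $n$ and last $n$ indices and conjugate). The range is $\mathscr{R}(\mathcal{A})=\{\mathcal{A}*_n\mathcal{X}:\mathcal{X}\in\mathbb{C}^{\mathbf{N}(n)}\}$. The index $\mathrm{ind}(\mathcal{A})$ is the smallest positive integer $k$ with $\mathscr{R}(\mathcal{A}^k)=\mathscr{R}(\mathcal{A}^{k+1})$. The core inverse $\mathcal{A}^{\mathrm{core}}$ is the (unique, existing when $\mathrm{ind}(\mathcal{A})=1$) tensor $\mathcal{X}$ with $(\mathcal{A}*_n\mathcal{X})^*=\mathcal{A}*_n\mathcal{X}$, $\mathcal{X}*_n\mathcal{A}^2=\mathcal{A}$, $\mathcal{A}*_n\mathcal{X}^2=\mathcal{X}$. The group inverse $\mathcal{A}^{\#}$ is the (unique, existing when $\mathrm{ind}(\mathcal{A})=1$)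 tensor $\mathcal{X}$ with $\mathcal{A}^2*_n\mathcal{X}=\mathcal{A}$, $\mathcal{X}*_n\mathcal{A}*_n\mathcal{X}=\mathcal{X}$, $\mathcal{X}*_n\mathcal{A}=\mathcal{A}*_n\mathcal{X}$. $\mathcal{C}\{5\}$ denotes the set of tensors $\mathcal{X}$ with $\mathcal{X}*_n\mathcal{C}=\mathcal{C}*_n\mathcal{X}$. *)

theory Defs
  imports Complex_Main
begin

text \<open>
  The shape \<open>N(n) = N_1 \<times> \<dots> \<times> N_n\<close> is the list \<open>N = [N_1, \<dots>, N_n]\<close>, so that
  \<open>n = length N\<close>; a multi-index \<open>(i_1, \<dots>, i_n)\<close> is the list \<open>[i_1, \<dots>, i_n]\<close>.
  The entry \<open>a_(i_1 \<dots> i_n j_1 \<dots> j_n)\<close> of a tensor of order \<open>2n\<close> is \<open>A i j\<close>.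
  Tensors of a given shape are required to vanish outside the index range, which makes
  equality of functions coincide with equality of tensors.
\<close>

type_synonym multi_index = "nat list"
type_synonym tensor = "multi_index \<Rightarrow> complex"
type_synonym square_tensor = "multi_index \<Rightarrow> multi_index \<Rightarrow> complex"

definition indices :: "nat list \<Rightarrow> multi_index set" where
  "indices N = {i. length i = length N \<and> (\<forall>k<length N. 1 \<le> i ! k \<and> i ! k \<le> N ! k)}"

definition tensors :: "nat list \<Rightarrow> tensor set" where
  "tensors N = {X. \<forall>i. i \<notin> indices N \<longrightarrow> X i = 0}"

definition square_tensors :: "nat list \<Rightarrow> square_tensor set" where
  "square_tensors N = {A. \<forall>i j. i \<notin> indices N \<or> j \<notin> indices N \<longrightarrow> A i j = 0}"

definition einstein_prod :: "square_tensor \<Rightarrow> nat list \<Rightarrow> square_tensor \<Rightarrow> square_tensor"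
    ("(_ \<star>\<^bsub>_\<^esub>/ _)" [70, 0, 71] 70) where
  "A \<star>\<^bsub>N\<^esub> B = (\<lambda>i j. \<Sum>k\<in>indices N. A i k * B k j)"

definition einstein_apply :: "nat list \<Rightarrow> square_tensor \<Rightarrow> tensor \<Rightarrow> tensor" where
  "einstein_apply N A X = (\<lambda>i. \<Sum>k\<in>indices N. A i k * X k)"

definition identity_tensor :: "nat list \<Rightarrow> square_tensor" where
  "identity_tensor N = (\<lambda>i j. if i = j \<and> i \<in> indices N then 1 else 0)"

primrec tensor_power :: "nat list \<Rightarrow> square_tensor \<Rightarrow> nat \<Rightarrow> square_tensor" where
  "tensor_power N A 0 = identity_tensor N"
| "tensor_power N A (Suc k) = A \<star>\<^bsub>N\<^esub> tensor_power N A k"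

definition conj_transpose :: "square_tensor \<Rightarrow> square_tensor" where
  "conj_transpose A = (\<lambda>i j. cnj (A j i))"

definition tensor_range :: "nat list \<Rightarrow> square_tensor \<Rightarrow> tensor set" where
  "tensor_range N A = einstein_apply N A ` tensors N"

definition tensor_index :: "nat list \<Rightarrow> square_tensor \<Rightarrow> nat" where
  "tensor_index N A =
    (LEAST k. 0 < k \<and> tensor_range N (tensor_power N A k) = tensor_range N (tensor_power N A (k + 1)))"

definition is_core_inverse :: "nat list \<Rightarrow> square_tensor \<Rightarrow> square_tensor \<Rightarrow> bool" where
  "is_core_inverse N A X \<longleftrightarrow>
     X \<in> square_tensors N \<and>
     conj_transpose (A \<star>\<^bsub>N\<^esub> X) = A \<star>\<^bsub>N\<^esub> X \<and>
     X \<star>\<^bsub>N\<^esub> tensor_power N A 2 = A \<and>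
     A \<star>\<^bsub>N\<^esub> tensor_power N X 2 = X"

text \<open>The two inverses below are meaningful only for tensors of index 1, for which they
  exist and are unique.\<close>

definition core_inverse :: "nat list \<Rightarrow> square_tensor \<Rightarrow> square_tensor" where
  "core_inverse N A = (THE X. is_core_inverse N A X)"

definition is_group_inverse :: "nat list \<Rightarrow> square_tensor \<Rightarrow> square_tensor \<Rightarrow> bool" where
  "is_group_inverse N A X \<longleftrightarrow>
     X \<in> square_tensors N \<and>
     tensor_power N A 2 \<star>\<^bsub>N\<^esub> X = A \<and>
     X \<star>\<^bsub>N\<^esub> A \<star>\<^bsub>N\<^esub> X = X \<and>
     X \<star>\<^bsub>N\<^esub> A = A \<star>\<^bsub>N\<^esub> X"

definition group_inverse :: "nat list \<Rightarrow> square_tensor \<Rightarrow> square_tensor" where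
  "group_inverse N A = (THE X. is_group_inverse N A X)"

text \<open>The set \<open>C{5}\<close>.\<close>

definition commuting_tensors :: "nat list \<Rightarrow> square_tensor \<Rightarrow> square_tensor set" where
  "commuting_tensors N C = {X \<in> square_tensors N. X \<star>\<^bsub>N\<^esub> C = C \<star>\<^bsub>N\<^esub> X}"

end

theory Submission
  imports Defs
begin

text \<open>
  Under the Einstein product and conjugate transposition, square tensors of a fixed shape
  form a semigroup with involution, and the equivalence is a statement about such a semigroup.
  Write \<open>X\<close> for the core inverse of \<open>B\<close>, \<open>D = A B\<close>, \<open>C = D X\<close>, \<open>Y\<close> for the core inverse
  of \<open>C\<close> and \<open>E\<close> for the group inverse of \<open>D\<close>. From \<open>B X B = B\<close> it follows that \<open>C B = D\<close>,
  so \<open>C\<close> and \<open>D\<close> have the same range, and \<open>D (X Y) = C Y\<close> is self-adjoint and fixes \<open>D\<close>.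

  If \<open>X Y\<close> commutes with \<open>D\<close>, then \<open>D = X (Y D D)\<close> has its range inside that of \<open>X\<close>, which
  is that of \<open>B\<close>; there \<open>B X\<close> and \<open>X B\<close> act as the identity, and the conditions in (c)
  result. Conversely those conditions make \<open>X Y\<close> satisfy the equations that define \<open>E\<close>, whence
  \<open>Y = B X Y = B E\<close>. Finally \<open>Y = B E\<close> again puts the range of \<open>D\<close> inside that of \<open>B\<close> and gives
  \<open>D E = C Y\<close>; so \<open>E = X Y\<close>, and \<open>D E\<close> is self-adjoint, which makes \<open>E\<close> the core inverse of
  \<open>D\<close> as well. Each step uses that core and group inverses are unique.

  The inverses also have to exist for tensors of index one, and this is where finite
  dimension enters. The powers of \<open>A\<close> are linearly dependent, and the lowest nonzero
  coefficient of a relation gives \<open>A\<^sup>m = A\<^sup>m A R\<close> for some \<open>R\<close> that commutes with \<open>A\<close>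
  (\<open>strongly_pi_regular\<close>). When \<open>A\<close> and \<open>A\<^sup>2\<close> have the same range this improves to
  \<open>A = R A\<^sup>2\<close>, and \<open>R\<^sup>2 A\<close> is the group inverse. Applied to \<open>A\<^sup>* A\<close>, it yields an inner inverse
  \<open>Z\<close> of \<open>A\<close> with \<open>A Z\<close> self-adjoint, because \<open>A\<^sup>* A\<close> may be cancelled to \<open>A\<close>
  (\<open>star_cancel\<close>). The group inverse times \<open>A Z\<close> is the core inverse.
\<close>

section \<open>Core and group inverses in a semigroup with involution\<close>

locale star_semigroup =
  fixes mult :: "'a \<Rightarrow> 'a \<Rightarrow> 'a" (infixl "\<cdot>" 70)
    and star :: "'a \<Rightarrow> 'a"
  assumes assoc: "(x \<cdot> y) \<cdot> z = x \<cdot> (y \<cdot> z)"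
    and star_star: "star (star x) = x"
    and star_mult: "star (x \<cdot> y) = star y \<cdot> star x"
begin

text \<open>The defining equations of the core and group inverses, as relations between an element
  and a candidate for its inverse.\<close>

definition core_inv :: "'a \<Rightarrow> 'a \<Rightarrow> bool" where
  "core_inv a x \<longleftrightarrow> star (a \<cdot> x) = a \<cdot> x \<and> x \<cdot> (a \<cdot> a) = a \<and> a \<cdot> (x \<cdot> x) = x"

definition group_inv :: "'a \<Rightarrow> 'a \<Rightarrow> bool" where
  "group_inv a x \<longleftrightarrow> a \<cdot> a \<cdot> x = a \<and> x \<cdot> a \<cdot> x = x \<and> x \<cdot> a = a \<cdot> x"

lemma core_inv_inner: assumes "core_inv a x" shows "a \<cdot> x \<cdot> a = a"
proof -
  have "a \<cdot> x \<cdot> a = (a \<cdot> (x \<cdot> x)) \<cdot> (a \<cdot> a)"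
    using assms unfolding core_inv_def by (metis assoc)
  then show ?thesis using assms by (simp add: core_inv_def)
qed

lemma core_inv_outer: assumes "core_inv a x" shows "x \<cdot> a \<cdot> x = x"
proof -
  have "x \<cdot> a \<cdot> x = (x \<cdot> (a \<cdot> a)) \<cdot> (x \<cdot> x)"
    using assms unfolding core_inv_def by (metis assoc)
  then show ?thesis using assms by (simp add: core_inv_def)
qed

lemma core_inv_unique:
  assumes x: "core_inv a x" and y: "core_inv a y"
  shows "x = y"
proof -
  \<comment> \<open>The products \<open>a \<cdot> x\<close> and \<open>a \<cdot> y\<close> are self-adjoint idempotents, and each fixes the other;
    taking adjoints shows that they are equal.\<close>
  have "a \<cdot> y = star ((a \<cdot> x \<cdot> a) \<cdot> y)"
    using y by (simp add: core_inv_inner[OF x] core_inv_def)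
  also have "\<dots> = star (a \<cdot> y) \<cdot> star (a \<cdot> x)"
    by (simp add: assoc flip: star_mult)
  also have "\<dots> = (a \<cdot> y \<cdot> a) \<cdot> x"
    using x y by (simp add: core_inv_def assoc)
  finally have eq: "a \<cdot> y = a \<cdot> x"
    by (simp add: core_inv_inner[OF y])
  have "x = x \<cdot> (a \<cdot> y)"
    by (simp add: eq core_inv_outer[OF x] flip: assoc)
  also have "\<dots> = x \<cdot> (a \<cdot> a) \<cdot> (y \<cdot> y)"
    using y unfolding core_inv_def by (metis assoc)
  also have "\<dots> = y"
    using x y by (simp add: core_inv_def)
  finally show ?thesis .
qed

lemma group_inv_inner: "group_inv a g \<Longrightarrow> a \<cdot> g \<cdot> a = a"
  unfolding group_inv_def by (metis assoc)

lemma group_inv_unique: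
  assumes g: "group_inv a g" and h: "group_inv a h"
  shows "g = h"
proof -
  have "a \<cdot> g = a \<cdot> h \<cdot> a \<cdot> g"
    by (simp add: group_inv_inner[OF h])
  also have "\<dots> = h \<cdot> (a \<cdot> g \<cdot> a)"
    using g h unfolding group_inv_def by (metis assoc)
  also have "\<dots> = a \<cdot> h"
    using h by (simp add: group_inv_inner[OF g] group_inv_def)
  finally have "a \<cdot> g = a \<cdot> h" .
  then show ?thesis
    using g h unfolding group_inv_def by (metis assoc)
qed

lemma group_inv_if_strongly_regular:
  assumes "a = r \<cdot> (a \<cdot> a)" and comm: "r \<cdot> a = a \<cdot> r"
  shows "group_inv a (r \<cdot> (r \<cdot> a))"
proof -
  have red: "a \<cdot> (a \<cdot> r) = a" "a \<cdot> (a \<cdot> (r \<cdot> z)) = a \<cdot> z" for z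
    using assms by (metis assoc)+
  have comm': "r \<cdot> (a \<cdot> z) = a \<cdot> (r \<cdot> z)" for z
    using comm by (metis assoc)
  show ?thesis
    by (simp add: group_inv_def assoc comm comm' red)
qed

text \<open>An inner inverse \<open>y\<close> of \<open>a\<close> for which \<open>a \<cdot> y\<close> is self-adjoint turns a group inverse
  into a core inverse.\<close>

lemma core_inv_if_group_inv:
  assumes g: "group_inv a g" and y: "a \<cdot> y \<cdot> a = a" "star (a \<cdot> y) = a \<cdot> y"
  shows "core_inv a (g \<cdot> (a \<cdot> y))"
proof -
  have aga: "a \<cdot> (g \<cdot> (a \<cdot> z)) = a \<cdot> z" and aya: "a \<cdot> (y \<cdot> (a \<cdot> z)) = a \<cdot> z" for z
    using group_inv_inner[OF g] y(1) by (metis assoc)+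
  have gaa: "g \<cdot> (a \<cdot> a) = a" and agg: "g = a \<cdot> (g \<cdot> g)"
    using g unfolding group_inv_def by (metis assoc)+
  have "a \<cdot> (y \<cdot> g) = g"
    using agg aya by metis
  then have ayg: "a \<cdot> (y \<cdot> (g \<cdot> z)) = g \<cdot> z" for z
    by (metis assoc)
  have agg': "a \<cdot> (g \<cdot> (g \<cdot> z)) = g \<cdot> z" for z
    using agg by (metis assoc)
  show ?thesis
    using y(2) by (simp add: core_inv_def assoc aga aya gaa ayg agg')
qed

text \<open>With \<open>p = a \<cdot> r \<cdot> star a\<close>, the hypothesis \<open>p \<cdot> a = a\<close> gives \<open>p \<cdot> star p = p\<close>.\<close>

lemma self_adjoint_if_left_unit:
  assumes "a \<cdot> r \<cdot> star a \<cdot> a = a"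
  shows "star (a \<cdot> r \<cdot> star a) = a \<cdot> r \<cdot> star a"
proof -
  let ?p = "a \<cdot> r \<cdot> star a"
  have "?p \<cdot> star ?p = a \<cdot> r \<cdot> star (?p \<cdot> a)"
    by (simp add: star_mult assoc)
  then have "?p \<cdot> star ?p = ?p"
    using assms by simp
  then show ?thesis
    by (metis star_mult star_star)
qed

end

section \<open>The reverse order law\<close>

text \<open>Here \<open>d\<close> is the product whose inverse is studied, \<open>x\<close> is the core inverse of \<open>b\<close>,
  \<open>y\<close> that of \<open>c = d \<cdot> x\<close>, and \<open>e\<close>, \<open>f\<close> are the group inverse and the core inverse
  of \<open>d\<close>.\<close>

locale reverse_order = star_semigroup +
  fixes a b c d x y e f
  assumes d_def: "d = a \<cdot> b"
    and c_def: "c = a \<cdot> b \<cdot> x"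
    and x: "core_inv b x"
    and y: "core_inv c y"
    and e: "group_inv d e"
    and f: "core_inv d f"
begin

lemma xbb: "x \<cdot> (b \<cdot> b) = b" and bxx: "b \<cdot> (x \<cdot> x) = x"
  and bxb: "b \<cdot> x \<cdot> b = b" and xbx: "x \<cdot> b \<cdot> x = x"
  using x core_inv_inner core_inv_outer by (simp_all add: core_inv_def)

lemma ycc: "y \<cdot> (c \<cdot> c) = c" and cyy: "c \<cdot> (y \<cdot> y) = y"
  and cyc: "c \<cdot> y \<cdot> c = c" and ycy: "y \<cdot> c \<cdot> y = y"
  and star_cy: "star (c \<cdot> y) = c \<cdot> y"
  using y core_inv_inner core_inv_outer by (simp_all add: core_inv_def)

lemma dde: "d \<cdot> d \<cdot> e = d" and ede: "e \<cdot> d \<cdot> e = e" and ed: "e \<cdot> d = d \<cdot> e"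
  using e unfolding group_inv_def by blast+

lemma dx: "d \<cdot> x = c" by (simp add: c_def d_def)

lemma cb: "c \<cdot> b = d"
  unfolding c_def d_def by (metis assoc bxb)

lemma cyd: "c \<cdot> y \<cdot> d = d"
  by (metis assoc cb cyc)

lemma dxy: "d \<cdot> (x \<cdot> y) = c \<cdot> y"
  by (simp add: dx flip: assoc)

text \<open>The element \<open>b \<cdot> x\<close> is a projection; once it fixes \<open>d\<close>, it also fixes \<open>y\<close>.\<close>

lemma projection_fixes:
  assumes "b \<cdot> x \<cdot> d = d"
  shows "b \<cdot> x \<cdot> y = y" and "a \<cdot> y = c \<cdot> y"
proof -
  have "b \<cdot> x \<cdot> c = c"
    using assms dx by (metis assoc)
  then show *: "b \<cdot> x \<cdot> y = y"
    using cyy by (metis assoc)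
  have "a \<cdot> y = a \<cdot> (b \<cdot> x \<cdot> y)"
    by (simp add: *)
  then show "a \<cdot> y = c \<cdot> y"
    by (simp add: c_def assoc)
qed

lemma range_conditions_if_commuting:
  assumes "x \<cdot> y \<cdot> d = d \<cdot> (x \<cdot> y)"
  shows "b \<cdot> x \<cdot> d = d" and "d = x \<cdot> b \<cdot> d" and "b \<cdot> a \<cdot> y = y \<cdot> d"
proof -
  have xyd: "x \<cdot> y \<cdot> d = c \<cdot> y"
    using assms dxy by simp
  then have d_eq: "d = x \<cdot> (y \<cdot> d \<cdot> d)"
    using cyd by (metis assoc)
  show bxd: "b \<cdot> x \<cdot> d = d"
    using d_eq bxx by (metis assoc)
  show "d = x \<cdot> b \<cdot> d"
    using d_eq xbx by (metis assoc)
  have "b \<cdot> a \<cdot> y = b \<cdot> x \<cdot> y \<cdot> d"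
    using projection_fixes(2)[OF bxd] xyd by (simp add: assoc)
  then show "b \<cdot> a \<cdot> y = y \<cdot> d"
    using projection_fixes(1)[OF bxd] by simp
qed

lemma core_inv_eq_if_range_conditions:
  assumes bxd: "b \<cdot> x \<cdot> d = d" and xbd: "d = x \<cdot> b \<cdot> d" and bay: "b \<cdot> a \<cdot> y = y \<cdot> d"
  shows "y = b \<cdot> e"
proof -
  have xbc: "x \<cdot> b \<cdot> c = c"
    using xbd dx by (metis assoc)
  have "x \<cdot> y \<cdot> d = x \<cdot> (b \<cdot> a \<cdot> y)"
    using bay by (metis assoc)
  also have "\<dots> = x \<cdot> b \<cdot> c \<cdot> y"
    by (simp add: projection_fixes(2)[OF bxd] assoc)
  finally have xyd: "x \<cdot> y \<cdot> d = c \<cdot> y"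
    by (simp add: xbc)
  have "d \<cdot> d \<cdot> (x \<cdot> y) = d \<cdot> (x \<cdot> y \<cdot> d)"
    using xyd dxy by (metis assoc)
  also have "\<dots> = d"
    using dxy cyd by (metis assoc)
  finally have "d \<cdot> d \<cdot> (x \<cdot> y) = d" .
  moreover have "x \<cdot> y \<cdot> d \<cdot> (x \<cdot> y) = x \<cdot> y"
    using dxy ycy by (simp add: assoc)
  ultimately have "group_inv d (x \<cdot> y)"
    using xyd dxy by (simp add: group_inv_def)
  then have "e = x \<cdot> y"
    using e group_inv_unique by blast
  then show ?thesis
    using projection_fixes(1)[OF bxd] by (simp add: assoc)
qed

lemma inverses_agree_if_core_inv_eq:
  assumes yb: "y = b \<cdot> e"
  shows "f = e" and "e = x \<cdot> y"
proof -
  have d_eq: "d = b \<cdot> (e \<cdot> c \<cdot> c \<cdot> b)"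
    using ycc cb yb by (metis assoc)
  have bxd: "b \<cdot> x \<cdot> d = d"
    using d_eq bxb by (metis assoc)
  have xbd: "x \<cdot> b \<cdot> d = d"
    using d_eq xbb by (metis assoc)
  have cy: "c \<cdot> y = d \<cdot> e"
    using projection_fixes(2)[OF bxd] yb by (simp add: d_def assoc)
  have dee: "d \<cdot> (e \<cdot> e) = e"
    using ede ed by (metis assoc)
  then show "e = x \<cdot> y"
    using xbd yb by (metis assoc)
  have "e \<cdot> (d \<cdot> d) = d"
    using dde ed by (metis assoc)
  then have "core_inv d e"
    using cy star_cy dee by (simp add: core_inv_def)
  then show "f = e"
    using f core_inv_unique by blast
qed

lemma commuting_if_inverses_agree: "e = x \<cdot> y \<Longrightarrow> x \<cdot> y \<cdot> d = d \<cdot> (x \<cdot> y)"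
  using ed by simp

end

section \<open>The algebra of square tensors\<close>

lemma finite_indices [simp]: "finite (indices N)"
proof (rule finite_subset)
  show "indices N \<subseteq> {i. set i \<subseteq> {..sum_list N} \<and> length i = length N}"
  proof
    fix i assume i: "i \<in> indices N"
    have "i ! k \<le> sum_list N" if "k < length N" for k
      using that i elem_le_sum_list[of k N] by (fastforce simp: indices_def)
    then show "i \<in> {i. set i \<subseteq> {..sum_list N} \<and> length i = length N}"
      using i by (auto simp: indices_def in_set_conv_nth)
  qed
  show "finite {i. set i \<subseteq> {..sum_list N} \<and> length i = length N}"
    by (rule finite_lists_length_eq) simp
qed

lemma einstein_prod_assoc: "(A \<star>\<^bsub>N\<^esub> B) \<star>\<^bsub>N\<^esub> C = A \<star>\<^bsub>N\<^esub> (B \<star>\<^bsub>N\<^esub> C)"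
  unfolding einstein_prod_def
  by (intro ext)
    (simp add: sum_distrib_left sum_distrib_right mult.assoc, subst sum.swap, rule refl)

interpretation tensor: star_semigroup "\<lambda>A B. A \<star>\<^bsub>N\<^esub> B" conj_transpose for N
proof
  show "(A \<star>\<^bsub>N\<^esub> B) \<star>\<^bsub>N\<^esub> C = A \<star>\<^bsub>N\<^esub> (B \<star>\<^bsub>N\<^esub> C)" for A B C
    by (rule einstein_prod_assoc)
  show "conj_transpose (conj_transpose A) = A" for A
    by (simp add: conj_transpose_def)
  show "conj_transpose (A \<star>\<^bsub>N\<^esub> B) = conj_transpose B \<star>\<^bsub>N\<^esub> conj_transpose A" for A B
    by (simp add: conj_transpose_def einstein_prod_def mult.commute)
qed

lemma square_tensors_D:
  "A \<in> square_tensors N \<Longrightarrow> i \<notin> indices N \<or> j \<notin> indices N \<Longrightarrow> A i j = 0"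
  by (auto simp: square_tensors_def)

lemma einstein_prod_closed [simp]:
  "A \<in> square_tensors N \<Longrightarrow> B \<in> square_tensors N \<Longrightarrow> A \<star>\<^bsub>N\<^esub> B \<in> square_tensors N"
  by (auto simp: square_tensors_def einstein_prod_def)

lemma conj_transpose_closed [simp]:
  "A \<in> square_tensors N \<Longrightarrow> conj_transpose A \<in> square_tensors N"
  by (auto simp: square_tensors_def conj_transpose_def)

lemma identity_tensor_closed [simp]: "identity_tensor N \<in> square_tensors N"
  by (auto simp: square_tensors_def identity_tensor_def)

lemma identity_tensor_right [simp]:
  assumes "A \<in> square_tensors N" shows "A \<star>\<^bsub>N\<^esub> identity_tensor N = A"
proof (intro ext)
  fix i j
  have "(A \<star>\<^bsub>N\<^esub> identity_tensor N) i j = (\<Sum>k\<in>indices N. if k = j then A i k else 0)"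
    unfolding einstein_prod_def identity_tensor_def by (rule sum.cong) auto
  also have "\<dots> = A i j"
    using square_tensors_D[OF assms] by simp
  finally show "(A \<star>\<^bsub>N\<^esub> identity_tensor N) i j = A i j" .
qed

lemma identity_tensor_left [simp]:
  assumes "A \<in> square_tensors N" shows "identity_tensor N \<star>\<^bsub>N\<^esub> A = A"
proof (intro ext)
  fix i j
  have "(identity_tensor N \<star>\<^bsub>N\<^esub> A) i j = (\<Sum>k\<in>indices N. if i = k then A k j else 0)"
    unfolding einstein_prod_def identity_tensor_def by (rule sum.cong) auto
  also have "\<dots> = A i j"
    using square_tensors_D[OF assms] by simp
  finally show "(identity_tensor N \<star>\<^bsub>N\<^esub> A) i j = A i j" .
qed

lemma tensor_power_closed [simp]: "A \<in> square_tensors N \<Longrightarrow> tensor_power N A k \<in> square_tensors N"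
  by (induction k) auto

lemma tensor_power_add:
  "A \<in> square_tensors N \<Longrightarrow>
    tensor_power N A (m + k) = tensor_power N A m \<star>\<^bsub>N\<^esub> tensor_power N A k"
  by (induction m) (auto simp: einstein_prod_assoc)

lemma tensor_power_two: "A \<in> square_tensors N \<Longrightarrow> tensor_power N A 2 = A \<star>\<^bsub>N\<^esub> A"
  by (simp add: numeral_2_eq_2)

lemma tensor_power_commute:
  assumes "B \<in> square_tensors N" and comm: "B \<star>\<^bsub>N\<^esub> A = A \<star>\<^bsub>N\<^esub> B"
  shows "B \<star>\<^bsub>N\<^esub> tensor_power N A k = tensor_power N A k \<star>\<^bsub>N\<^esub> B"
proof (induction k)
  case 0
  then show ?case using assms by simp
next
  case (Suc k)
  have "B \<star>\<^bsub>N\<^esub> tensor_power N A (Suc k) = A \<star>\<^bsub>N\<^esub> (B \<star>\<^bsub>N\<^esub> tensor_power N A k)"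
    by (simp add: comm flip: einstein_prod_assoc)
  then show ?case by (simp add: Suc einstein_prod_assoc)
qed

text \<open>The involution is proper: \<open>(A X - A Y)\<^sup>* (A X - A Y)\<close> vanishes only if each column of
  \<open>A X - A Y\<close> does.\<close>

lemma star_cancel:
  assumes A: "A \<in> square_tensors N"
    and eq: "conj_transpose A \<star>\<^bsub>N\<^esub> (A \<star>\<^bsub>N\<^esub> X) = conj_transpose A \<star>\<^bsub>N\<^esub> (A \<star>\<^bsub>N\<^esub> Y)"
  shows "A \<star>\<^bsub>N\<^esub> X = A \<star>\<^bsub>N\<^esub> Y"
proof (intro ext)
  fix i j
  define D where "D k = (A \<star>\<^bsub>N\<^esub> X) k j - (A \<star>\<^bsub>N\<^esub> Y) k j" for k
  have orth: "(\<Sum>k\<in>indices N. cnj (A k l) * D k) = 0" for l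
    using fun_cong[OF fun_cong[OF eq, of l], of j]
    unfolding einstein_prod_def[of "conj_transpose A"] D_def
    by (simp add: conj_transpose_def right_diff_distrib sum_subtractf)
  have D: "D k = (\<Sum>l\<in>indices N. A k l * (X l j - Y l j))" for k
    by (simp add: D_def einstein_prod_def right_diff_distrib sum_subtractf)
  have "(\<Sum>k\<in>indices N. cnj (D k) * D k) =
      (\<Sum>k\<in>indices N. \<Sum>l\<in>indices N. cnj (X l j - Y l j) * (cnj (A k l) * D k))"
    by (subst (1) D) (simp add: sum_distrib_left mult_ac)
  also have "\<dots> = (\<Sum>l\<in>indices N. cnj (X l j - Y l j) * (\<Sum>k\<in>indices N. cnj (A k l) * D k))"
    by (subst sum.swap) (simp add: sum_distrib_left)
  also have "\<dots> = 0" by (simp add: orth)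
  finally have "complex_of_real (\<Sum>k\<in>indices N. (cmod (D k))\<^sup>2) = 0"
    unfolding of_real_sum complex_norm_square by (simp only: mult.commute)
  then have "(\<Sum>k\<in>indices N. (cmod (D k))\<^sup>2) = 0"
    by (simp only: of_real_eq_0_iff)
  then have "D k = 0" if "k \<in> indices N" for k
    using that by (simp add: sum_nonneg_eq_0_iff)
  moreover have "D k = 0" if "k \<notin> indices N" for k
    using that square_tensors_D[OF A] by (simp add: D)
  ultimately have "D i = 0" by blast
  then show "(A \<star>\<^bsub>N\<^esub> X) i j = (A \<star>\<^bsub>N\<^esub> Y) i j"
    by (simp add: D_def)
qed

section \<open>A polynomial relation between powers\<close>

text \<open>A homogeneous linear system with more unknowns than equations has a nontrivial solution.\<close>

lemma nontrivial_relation: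
  fixes f :: "'i \<Rightarrow> 's \<Rightarrow> 'k::field"
  assumes "finite S" and "finite I" and "card S < card I"
  shows "\<exists>c. (\<exists>i\<in>I. c i \<noteq> 0) \<and> (\<forall>s\<in>S. (\<Sum>i\<in>I. c i * f i s) = 0)"
  using assms
proof (induction S arbitrary: I f rule: finite_induct)
  case empty
  then have "I \<noteq> {}" by auto
  then show ?case by (intro exI[of _ "\<lambda>_. 1"]) auto
next
  case (insert s S)
  show ?case
  proof (cases "\<forall>i\<in>I. f i s = 0")
    case True
    have "card S < card I" using insert by simp
    then obtain c where "\<exists>i\<in>I. c i \<noteq> 0" "\<forall>t\<in>S. (\<Sum>i\<in>I. c i * f i t) = 0"
      using insert.IH[of I f] insert.prems by blast
    then show ?thesis using True by (intro exI[of _ c]) auto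
  next
    case False
    then obtain p where p: "p \<in> I" "f p s \<noteq> 0" by blast
    \<comment> \<open>Equation \<open>s\<close> is used to eliminate the unknown \<open>p\<close>.\<close>
    define g where "g i t = f i t - f i s / f p s * f p t" for i t
    have "card S < card (I - {p})"
      using insert p by simp
    then obtain c where c: "\<exists>i\<in>I - {p}. c i \<noteq> 0"
        "\<And>t. t \<in> S \<Longrightarrow> (\<Sum>i\<in>I - {p}. c i * g i t) = 0"
      using insert.IH[of "I - {p}" g] insert.prems by blast
    define c' where "c' = c(p := - (\<Sum>i\<in>I - {p}. c i * (f i s / f p s)))"
    have "(\<Sum>i\<in>I. c' i * f i t) = (\<Sum>i\<in>I - {p}. c i * g i t)" for t
    proof -
      have "(\<Sum>i\<in>I. c' i * f i t) = c' p * f p t + (\<Sum>i\<in>I - {p}. c' i * f i t)"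
        using p insert.prems by (simp add: sum.remove)
      also have "(\<Sum>i\<in>I - {p}. c' i * f i t) = (\<Sum>i\<in>I - {p}. c i * f i t)"
        by (rule sum.cong) (auto simp: c'_def)
      finally show ?thesis
        by (simp add: c'_def g_def right_diff_distrib sum_subtractf sum_distrib_right mult.assoc)
    qed
    moreover have "g i s = 0" for i
      using p by (simp add: g_def)
    moreover have "\<exists>i\<in>I. c' i \<noteq> 0"
      using c(1) by (auto simp: c'_def)
    ultimately show ?thesis
      using c(2) by (intro exI[of _ c']) auto
  qed
qed

lemma einstein_prod_sum_right:
  "A \<star>\<^bsub>N\<^esub> (\<lambda>i j. \<Sum>k\<in>K. u k * F k i j) = (\<lambda>i j. \<Sum>k\<in>K. u k * (A \<star>\<^bsub>N\<^esub> F k) i j)"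
  unfolding einstein_prod_def
  by (intro ext) (simp add: sum_distrib_left mult.left_commute, rule sum.swap)

lemma einstein_prod_sum_left:
  "(\<lambda>i j. \<Sum>k\<in>K. u k * F k i j) \<star>\<^bsub>N\<^esub> A = (\<lambda>i j. \<Sum>k\<in>K. u k * (F k \<star>\<^bsub>N\<^esub> A) i j)"
  unfolding einstein_prod_def
  by (intro ext) (simp add: sum_distrib_left sum_distrib_right mult.assoc, rule sum.swap)

text \<open>Every square tensor is strongly \<open>\<pi>\<close>-regular: dividing a nontrivial polynomial relation
  satisfied by \<open>A\<close> by its lowest nonzero coefficient gives \<open>A\<^sup>m = A\<^sup>m A R\<close> with \<open>R\<close> a
  polynomial in \<open>A\<close>.\<close>

lemma strongly_pi_regular:
  assumes A: "A \<in> square_tensors N"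
  obtains m R where "R \<in> square_tensors N" and "R \<star>\<^bsub>N\<^esub> A = A \<star>\<^bsub>N\<^esub> R"
    and "tensor_power N A m = tensor_power N A m \<star>\<^bsub>N\<^esub> (A \<star>\<^bsub>N\<^esub> R)"
proof -
  let ?S = "indices N \<times> indices N"
  define n where "n = card ?S"
  obtain c where c: "\<exists>k\<in>{..n}. c k \<noteq> 0"
      "\<And>s. s \<in> ?S \<Longrightarrow> (\<Sum>k\<le>n. c k * tensor_power N A k (fst s) (snd s)) = 0"
    using nontrivial_relation[of ?S "{..n}" "\<lambda>k s. tensor_power N A k (fst s) (snd s)"]
    by (fastforce simp: n_def simp del: card_cartesian_product)
  define m where "m = (LEAST k. c k \<noteq> 0)"
  have below: "c k = 0" if "k < m" for k
    using that not_less_Least[of k "\<lambda>k. c k \<noteq> 0"] unfolding m_def by blast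
  have m: "c m \<noteq> 0"
    using c(1) unfolding m_def by (metis (mono_tags, lifting) LeastI)
  have "m \<le> n"
    using c(1) below by (meson atMost_iff le_less_trans not_le)
  define u where "u k = - (c k / c m)" for k
  define R where "R = (\<lambda>i j. \<Sum>k\<in>{m<..n}. u k * tensor_power N A (k - Suc m) i j)"
  have "R \<in> square_tensors N"
    using square_tensors_D[OF tensor_power_closed[OF A]] by (auto simp: R_def square_tensors_def)
  moreover have "R \<star>\<^bsub>N\<^esub> A = A \<star>\<^bsub>N\<^esub> R"
    unfolding R_def einstein_prod_sum_left einstein_prod_sum_right
    by (simp add: tensor_power_commute[OF A refl])
  moreover have "tensor_power N A m = tensor_power N A m \<star>\<^bsub>N\<^esub> (A \<star>\<^bsub>N\<^esub> R)"
  proof (intro ext)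
    fix i j
    have pow: "tensor_power N A m \<star>\<^bsub>N\<^esub> (A \<star>\<^bsub>N\<^esub> tensor_power N A (k - Suc m)) = tensor_power N A k"
      if "m < k" for k
      using that tensor_power_add[OF A, of m "Suc (k - Suc m)"] by simp
    have rhs: "(tensor_power N A m \<star>\<^bsub>N\<^esub> (A \<star>\<^bsub>N\<^esub> R)) i j =
        (\<Sum>k\<in>{m<..n}. u k * tensor_power N A k i j)"
      unfolding R_def einstein_prod_sum_right by (rule sum.cong) (auto simp: pow)
    show "tensor_power N A m i j = (tensor_power N A m \<star>\<^bsub>N\<^esub> (A \<star>\<^bsub>N\<^esub> R)) i j"
    proof (cases "(i, j) \<in> ?S")
      case True
      have "0 = (\<Sum>k\<le>n. c k * tensor_power N A k i j)"
        using c(2)[OF True] by simp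
      also have "\<dots> = (\<Sum>k\<in>{m..n}. c k * tensor_power N A k i j)"
        by (rule sum.mono_neutral_right) (auto simp: below)
      also have "\<dots> = c m * tensor_power N A m i j
          + (\<Sum>k\<in>{m<..n}. c k * tensor_power N A k i j)"
        using \<open>m \<le> n\<close> by (simp add: sum.head)
      also have "(\<Sum>k\<in>{m<..n}. c k * tensor_power N A k i j)
          = - c m * (\<Sum>k\<in>{m<..n}. u k * tensor_power N A k i j)"
        using m by (simp add: u_def sum_distrib_left sum_negf)
      finally show ?thesis
        using m by (simp add: rhs)
    next
      case False
      then show ?thesis
        using square_tensors_D[OF tensor_power_closed[OF A]] by (auto simp: rhs)
    qed
  qed
  ultimately show thesis by (rule that)
qed

section \<open>Existence of the inverses\<close>

text \<open>Powers of a self-adjoint tensor can be cancelled down to the first.\<close>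

lemma self_adjoint_power_cancel:
  assumes H: "H \<in> square_tensors N" "conj_transpose H = H"
    and "tensor_power N H (Suc k) \<star>\<^bsub>N\<^esub> X = tensor_power N H (Suc k) \<star>\<^bsub>N\<^esub> Y"
  shows "H \<star>\<^bsub>N\<^esub> X = H \<star>\<^bsub>N\<^esub> Y"
  using assms(3)
proof (induction k)
  case 0
  then show ?case using H by simp
next
  case (Suc k)
  have "conj_transpose H \<star>\<^bsub>N\<^esub> (H \<star>\<^bsub>N\<^esub> (tensor_power N H k \<star>\<^bsub>N\<^esub> X)) =
      conj_transpose H \<star>\<^bsub>N\<^esub> (H \<star>\<^bsub>N\<^esub> (tensor_power N H k \<star>\<^bsub>N\<^esub> Y))"
    using Suc.prems by (simp add: H(2) einstein_prod_assoc)
  from star_cancel[OF H(1) this] show ?case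
    by (intro Suc.IH) (simp add: einstein_prod_assoc)
qed

lemma inner_inverse_self_adjoint:
  assumes A: "A \<in> square_tensors N"
  obtains Y where "Y \<in> square_tensors N" and "A \<star>\<^bsub>N\<^esub> Y \<star>\<^bsub>N\<^esub> A = A"
    and "conj_transpose (A \<star>\<^bsub>N\<^esub> Y) = A \<star>\<^bsub>N\<^esub> Y"
proof -
  let ?H = "conj_transpose A \<star>\<^bsub>N\<^esub> A"
  have H: "?H \<in> square_tensors N" "conj_transpose ?H = ?H"
    using A by (simp_all add: tensor.star_mult tensor.star_star)
  obtain m R where R: "R \<in> square_tensors N" and comm: "R \<star>\<^bsub>N\<^esub> ?H = ?H \<star>\<^bsub>N\<^esub> R"
    and pow: "tensor_power N ?H m = tensor_power N ?H m \<star>\<^bsub>N\<^esub> (?H \<star>\<^bsub>N\<^esub> R)"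
    using strongly_pi_regular[OF H(1)] by blast
  have "tensor_power N ?H (Suc m) \<star>\<^bsub>N\<^esub> identity_tensor N =
      tensor_power N ?H (Suc m) \<star>\<^bsub>N\<^esub> (?H \<star>\<^bsub>N\<^esub> R)"
    using pow H(1) by (simp add: einstein_prod_assoc)
  from self_adjoint_power_cancel[OF H this]
  have "?H \<star>\<^bsub>N\<^esub> identity_tensor N = ?H \<star>\<^bsub>N\<^esub> (R \<star>\<^bsub>N\<^esub> ?H)"
    by (simp add: comm)
  then have "A \<star>\<^bsub>N\<^esub> identity_tensor N = A \<star>\<^bsub>N\<^esub> (R \<star>\<^bsub>N\<^esub> ?H)"
    by (intro star_cancel[OF A]) (simp add: einstein_prod_assoc)
  then have ARA: "A \<star>\<^bsub>N\<^esub> R \<star>\<^bsub>N\<^esub> conj_transpose A \<star>\<^bsub>N\<^esub> A = A"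
    using A by (simp add: einstein_prod_assoc)
  show thesis
  proof (rule that)
    show "R \<star>\<^bsub>N\<^esub> conj_transpose A \<in> square_tensors N"
      using A R by simp
    show "A \<star>\<^bsub>N\<^esub> (R \<star>\<^bsub>N\<^esub> conj_transpose A) \<star>\<^bsub>N\<^esub> A = A"
      using ARA by (simp add: einstein_prod_assoc)
    show "conj_transpose (A \<star>\<^bsub>N\<^esub> (R \<star>\<^bsub>N\<^esub> conj_transpose A)) = A \<star>\<^bsub>N\<^esub> (R \<star>\<^bsub>N\<^esub> conj_transpose A)"
      using tensor.self_adjoint_if_left_unit[OF ARA] by (simp add: einstein_prod_assoc)
  qed
qed

lemma einstein_apply_prod:
  "einstein_apply N (A \<star>\<^bsub>N\<^esub> B) X = einstein_apply N A (einstein_apply N B X)"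
  unfolding einstein_apply_def einstein_prod_def
  by (intro ext)
    (simp add: sum_distrib_left sum_distrib_right mult.assoc, subst sum.swap, rule refl)

lemma einstein_apply_closed: "A \<in> square_tensors N \<Longrightarrow> einstein_apply N A X \<in> tensors N"
  by (auto simp: square_tensors_def tensors_def einstein_apply_def)

lemma tensor_range_prod_subset:
  "B \<in> square_tensors N \<Longrightarrow> tensor_range N (A \<star>\<^bsub>N\<^esub> B) \<subseteq> tensor_range N A"
  by (auto simp: tensor_range_def einstein_apply_prod einstein_apply_closed)

lemma tensor_range_subset_imp_factor:
  assumes A: "A \<in> square_tensors N" and sub: "tensor_range N A \<subseteq> tensor_range N B"
  obtains Y where "A = B \<star>\<^bsub>N\<^esub> Y"
proof -
  \<comment> \<open>Column \<open>j\<close> of \<open>A\<close> is the image of column \<open>j\<close> of the identity.\<close>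
  have "\<exists>X. (\<lambda>i. A i j) = einstein_apply N B X" for j
  proof -
    have "(\<lambda>i. identity_tensor N i j) \<in> tensors N"
      by (auto simp: tensors_def identity_tensor_def)
    moreover have "(\<lambda>i. A i j) = einstein_apply N A (\<lambda>i. identity_tensor N i j)"
      using fun_cong[OF fun_cong[OF identity_tensor_right[OF A]], of _ j]
      by (simp add: einstein_apply_def einstein_prod_def)
    ultimately have "(\<lambda>i. A i j) \<in> tensor_range N A"
      by (auto simp: tensor_range_def)
    then show ?thesis
      using sub by (auto simp: tensor_range_def)
  qed
  then obtain X where X: "\<And>j. (\<lambda>i. A i j) = einstein_apply N B (X j)"
    by metis
  have "A = B \<star>\<^bsub>N\<^esub> (\<lambda>k j. X j k)"
    using fun_cong[OF X] by (intro ext) (simp add: einstein_apply_def einstein_prod_def)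
  then show thesis by (rule that)
qed

text \<open>The least number in the definition of the index is attained, because by
  strong \<open>\<pi>\<close>-regularity the ranges of the powers become stationary.\<close>

lemma tensor_range_square:
  assumes A: "A \<in> square_tensors N" and ind: "tensor_index N A = 1"
  shows "tensor_range N A = tensor_range N (A \<star>\<^bsub>N\<^esub> A)"
proof -
  obtain m R where R: "R \<in> square_tensors N"
    and pow: "tensor_power N A m = tensor_power N A m \<star>\<^bsub>N\<^esub> (A \<star>\<^bsub>N\<^esub> R)"
    using strongly_pi_regular[OF A] by blast
  \<comment> \<open>The exponent has to be positive, while \<open>m\<close> may be zero.\<close>
  define k where "k = Suc m"
  have pow': "tensor_power N A (k + 1) = tensor_power N A k \<star>\<^bsub>N\<^esub> A"
    using tensor_power_add[OF A, of k 1] A by simp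
  have "tensor_power N A k = tensor_power N A (k + 1) \<star>\<^bsub>N\<^esub> R"
    using pow unfolding pow' by (simp add: k_def einstein_prod_assoc)
  then have "tensor_range N (tensor_power N A k) = tensor_range N (tensor_power N A (k + 1))"
    using tensor_range_prod_subset[OF R] tensor_range_prod_subset[OF A] pow' by (metis subset_antisym)
  then have "0 < k \<and> tensor_range N (tensor_power N A k) = tensor_range N (tensor_power N A (k + 1))"
    by (simp add: k_def)
  from LeastI[of "\<lambda>k. 0 < k \<and> tensor_range N (tensor_power N A k) =
      tensor_range N (tensor_power N A (k + 1))", OF this]
  have "tensor_range N (tensor_power N A 1) = tensor_range N (tensor_power N A (1 + 1))"
    using ind unfolding tensor_index_def by simp
  then show ?thesis using A by simp
qed

lemma index_one_imp_strongly_regular: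
  assumes A: "A \<in> square_tensors N" and ind: "tensor_index N A = 1"
  obtains R where "R \<in> square_tensors N" and "R \<star>\<^bsub>N\<^esub> A = A \<star>\<^bsub>N\<^esub> R"
    and "A = R \<star>\<^bsub>N\<^esub> (A \<star>\<^bsub>N\<^esub> A)"
proof -
  obtain m R where R: "R \<in> square_tensors N" and comm: "R \<star>\<^bsub>N\<^esub> A = A \<star>\<^bsub>N\<^esub> R"
    and pow: "tensor_power N A m = tensor_power N A m \<star>\<^bsub>N\<^esub> (A \<star>\<^bsub>N\<^esub> R)"
    using strongly_pi_regular[OF A] by blast
  obtain Y where Y: "A = A \<star>\<^bsub>N\<^esub> A \<star>\<^bsub>N\<^esub> Y"
    using tensor_range_subset_imp_factor[OF A] tensor_range_square[OF A ind] by blast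
  \<comment> \<open>Substituting \<open>A = A A Y\<close> into itself gives every power of \<open>A\<close> as a left factor.\<close>
  have "\<exists>W. A = tensor_power N A k \<star>\<^bsub>N\<^esub> A \<star>\<^bsub>N\<^esub> W" for k
  proof (induction k)
    case 0
    show ?case using A by (intro exI[of _ "identity_tensor N"]) simp
  next
    case (Suc k)
    then obtain W where W: "A = tensor_power N A k \<star>\<^bsub>N\<^esub> A \<star>\<^bsub>N\<^esub> W" ..
    have "tensor_power N A (Suc k) = tensor_power N A k \<star>\<^bsub>N\<^esub> A"
      using tensor_power_commute[OF A refl] by simp
    then have "tensor_power N A (Suc k) \<star>\<^bsub>N\<^esub> A \<star>\<^bsub>N\<^esub> (Y \<star>\<^bsub>N\<^esub> W) =
        tensor_power N A k \<star>\<^bsub>N\<^esub> (A \<star>\<^bsub>N\<^esub> A \<star>\<^bsub>N\<^esub> Y) \<star>\<^bsub>N\<^esub> W"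
      by (simp only: einstein_prod_assoc)
    also have "\<dots> = A"
      by (simp only: flip: Y W)
    finally show ?case by (intro exI) (rule sym)
  qed
  then obtain W where W: "A = tensor_power N A m \<star>\<^bsub>N\<^esub> A \<star>\<^bsub>N\<^esub> W"
    by blast
  have "A \<star>\<^bsub>N\<^esub> R \<star>\<^bsub>N\<^esub> A = A \<star>\<^bsub>N\<^esub> (A \<star>\<^bsub>N\<^esub> R)"
    by (simp add: comm einstein_prod_assoc)
  then have comm': "A \<star>\<^bsub>N\<^esub> R \<star>\<^bsub>N\<^esub> tensor_power N A m = tensor_power N A m \<star>\<^bsub>N\<^esub> (A \<star>\<^bsub>N\<^esub> R)"
    by (intro tensor_power_commute) (simp_all add: A R)
  have "R \<star>\<^bsub>N\<^esub> (A \<star>\<^bsub>N\<^esub> A) = A \<star>\<^bsub>N\<^esub> R \<star>\<^bsub>N\<^esub> A"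
    by (simp add: comm flip: einstein_prod_assoc)
  also have "\<dots> = A \<star>\<^bsub>N\<^esub> R \<star>\<^bsub>N\<^esub> tensor_power N A m \<star>\<^bsub>N\<^esub> A \<star>\<^bsub>N\<^esub> W"
    using arg_cong[OF W, of "\<lambda>Z. A \<star>\<^bsub>N\<^esub> R \<star>\<^bsub>N\<^esub> Z"] by (simp only: einstein_prod_assoc)
  also have "\<dots> = A"
    by (simp only: comm' flip: pow W)
  finally have "A = R \<star>\<^bsub>N\<^esub> (A \<star>\<^bsub>N\<^esub> A)" ..
  then show thesis using that R comm by blast
qed

lemma is_group_inverse_iff:
  "A \<in> square_tensors N \<Longrightarrow>
    is_group_inverse N A X \<longleftrightarrow> X \<in> square_tensors N \<and> tensor.group_inv N A X"
  by (simp add: is_group_inverse_def tensor.group_inv_def tensor_power_two)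

lemma is_core_inverse_iff:
  "A \<in> square_tensors N \<Longrightarrow>
    is_core_inverse N A X \<longleftrightarrow> X \<in> square_tensors N \<and> tensor.core_inv N A X"
  by (auto simp: is_core_inverse_def tensor.core_inv_def tensor_power_two)

lemma group_inverse_index_one:
  assumes A: "A \<in> square_tensors N" and ind: "tensor_index N A = 1"
  shows "group_inverse N A \<in> square_tensors N" and "tensor.group_inv N A (group_inverse N A)"
proof -
  obtain R where "R \<in> square_tensors N" "R \<star>\<^bsub>N\<^esub> A = A \<star>\<^bsub>N\<^esub> R" "A = R \<star>\<^bsub>N\<^esub> (A \<star>\<^bsub>N\<^esub> A)"
    using index_one_imp_strongly_regular[OF assms] by blast
  then have "is_group_inverse N A (R \<star>\<^bsub>N\<^esub> (R \<star>\<^bsub>N\<^esub> A))"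
    using A tensor.group_inv_if_strongly_regular by (simp add: is_group_inverse_iff)
  then have "\<exists>!X. is_group_inverse N A X"
    using tensor.group_inv_unique unfolding is_group_inverse_iff[OF A] by blast
  then have "is_group_inverse N A (group_inverse N A)"
    unfolding group_inverse_def by (rule theI')
  then show "group_inverse N A \<in> square_tensors N" "tensor.group_inv N A (group_inverse N A)"
    by (simp_all add: is_group_inverse_iff[OF A])
qed

lemma core_inverse_index_one:
  assumes A: "A \<in> square_tensors N" and ind: "tensor_index N A = 1"
  shows "core_inverse N A \<in> square_tensors N" and "tensor.core_inv N A (core_inverse N A)"
proof -
  obtain Y where "Y \<in> square_tensors N" "A \<star>\<^bsub>N\<^esub> Y \<star>\<^bsub>N\<^esub> A = A"
      "conj_transpose (A \<star>\<^bsub>N\<^esub> Y) = A \<star>\<^bsub>N\<^esub> Y"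
    using inner_inverse_self_adjoint[OF A] by blast
  then have "is_core_inverse N A (group_inverse N A \<star>\<^bsub>N\<^esub> (A \<star>\<^bsub>N\<^esub> Y))"
    using A tensor.core_inv_if_group_inv group_inverse_index_one[OF assms]
    by (simp add: is_core_inverse_iff)
  then have "\<exists>!X. is_core_inverse N A X"
    using tensor.core_inv_unique unfolding is_core_inverse_iff[OF A] by blast
  then have "is_core_inverse N A (core_inverse N A)"
    unfolding core_inverse_def by (rule theI')
  then show "core_inverse N A \<in> square_tensors N" "tensor.core_inv N A (core_inverse N A)"
    by (simp_all add: is_core_inverse_iff[OF A])
qed

section \<open>The equivalence for tensors\<close>

theorem theorem4p1:
  fixes N :: "nat list" and A B :: square_tensor
  assumes "N \<noteq> []" and "\<forall>d\<in>set N. 1 \<le> d"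
    and "A \<in> square_tensors N" and "B \<in> square_tensors N"
    and "tensor_index N B = 1"
    and "tensor_index N (A \<star>\<^bsub>N\<^esub> B) = 1"
    and "tensor_index N (A \<star>\<^bsub>N\<^esub> B \<star>\<^bsub>N\<^esub> core_inverse N B) = 1"
  defines "a \<equiv>
      core_inverse N (A \<star>\<^bsub>N\<^esub> B) = group_inverse N (A \<star>\<^bsub>N\<^esub> B) \<and>
      group_inverse N (A \<star>\<^bsub>N\<^esub> B) =
        core_inverse N B \<star>\<^bsub>N\<^esub> core_inverse N (A \<star>\<^bsub>N\<^esub> B \<star>\<^bsub>N\<^esub> core_inverse N B)"
    and "b \<equiv>
      core_inverse N B \<star>\<^bsub>N\<^esub> core_inverse N (A \<star>\<^bsub>N\<^esub> B \<star>\<^bsub>N\<^esub> core_inverse N B)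
        \<in> commuting_tensors N (A \<star>\<^bsub>N\<^esub> B)"
    and "c \<equiv>
      B \<star>\<^bsub>N\<^esub> core_inverse N B \<star>\<^bsub>N\<^esub> A \<star>\<^bsub>N\<^esub> B = A \<star>\<^bsub>N\<^esub> B \<and>
      A \<star>\<^bsub>N\<^esub> B = core_inverse N B \<star>\<^bsub>N\<^esub> B \<star>\<^bsub>N\<^esub> A \<star>\<^bsub>N\<^esub> B \<and>
      B \<star>\<^bsub>N\<^esub> A \<star>\<^bsub>N\<^esub> core_inverse N (A \<star>\<^bsub>N\<^esub> B \<star>\<^bsub>N\<^esub> core_inverse N B) =
        core_inverse N (A \<star>\<^bsub>N\<^esub> B \<star>\<^bsub>N\<^esub> core_inverse N B) \<star>\<^bsub>N\<^esub> A \<star>\<^bsub>N\<^esub> B"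
    and "d \<equiv>
      core_inverse N (A \<star>\<^bsub>N\<^esub> B \<star>\<^bsub>N\<^esub> core_inverse N B) =
        B \<star>\<^bsub>N\<^esub> group_inverse N (A \<star>\<^bsub>N\<^esub> B)"
  shows "(a \<longleftrightarrow> b) \<and> (b \<longleftrightarrow> c) \<and> (c \<longleftrightarrow> d)"
proof -
  let ?D = "A \<star>\<^bsub>N\<^esub> B"
  let ?X = "core_inverse N B"
  let ?C = "?D \<star>\<^bsub>N\<^esub> ?X"
  let ?Y = "core_inverse N ?C"
  let ?E = "group_inverse N ?D"
  have D: "?D \<in> square_tensors N"
    using assms(3,4) by simp
  note X = core_inverse_index_one[OF assms(4,5)]
  have C: "?C \<in> square_tensors N"
    using D X(1) by simp
  note Y = core_inverse_index_one[OF C assms(7)]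
  interpret rev: reverse_order "\<lambda>A B. A \<star>\<^bsub>N\<^esub> B" conj_transpose A B ?C ?D ?X ?Y ?E "core_inverse N ?D"
    using X(2) Y(2) group_inverse_index_one(2)[OF D assms(6)]
      core_inverse_index_one(2)[OF D assms(6)]
    by unfold_locales simp_all
  have b_iff: "b \<longleftrightarrow> ?X \<star>\<^bsub>N\<^esub> ?Y \<star>\<^bsub>N\<^esub> ?D = ?D \<star>\<^bsub>N\<^esub> (?X \<star>\<^bsub>N\<^esub> ?Y)"
    using X(1) Y(1) by (simp add: b_def commuting_tensors_def)
  have c_iff: "c \<longleftrightarrow> B \<star>\<^bsub>N\<^esub> ?X \<star>\<^bsub>N\<^esub> ?D = ?D \<and> ?D = ?X \<star>\<^bsub>N\<^esub> B \<star>\<^bsub>N\<^esub> ?D \<and>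
      B \<star>\<^bsub>N\<^esub> A \<star>\<^bsub>N\<^esub> ?Y = ?Y \<star>\<^bsub>N\<^esub> ?D"
    by (simp add: c_def einstein_prod_assoc)
  have "b \<Longrightarrow> c"
    using rev.range_conditions_if_commuting unfolding b_iff c_iff by blast
  moreover have "c \<Longrightarrow> d"
    using rev.core_inv_eq_if_range_conditions unfolding c_iff d_def by blast
  moreover have "d \<Longrightarrow> a"
    using rev.inverses_agree_if_core_inv_eq unfolding d_def a_def by blast
  moreover have "a \<Longrightarrow> b"
    using rev.commuting_if_inverses_agree unfolding a_def b_iff by blast
  ultimately show ?thesis by blast
qed

end
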